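(* Fix a real $r > \frac{1}{2}$, a natural number $n$, and a natural number $m < n$. Let $t \in \mathbb{N}$, let $b_1, \dots, b_t$ be distinct integers and $l_1, \dots, l_t$ natural numbers with $l_1 + \dots + l_t = m$. Let $$V = \{x = (x_1,\dots,x_m) : x_i \in \{b_1,\dots,b_t\},\ |\{i : x_i = b_j\}| = l_j \text{ for } j = 1,\dots,t\}.$$ Let $d$ be the largest natural number such that $(x,y) \equiv 0 \pmod d$ for all $x, y \in V$, where $(\cdot,\cdot)$ is the Euclidean scalar product. Let $\overline{s} = \max_{x,y \in V}(x,y)$ and $\underline{s} = \min_{x,y\in V}(x,y)$. Define $a'$ by $\frac{\sqrt{\overline{s}}}{\sqrt{2\overline{s} - 2a'}} = r$, let $p$ be the smallest prime with $p > \frac{\overline{s} - a'}{d}$, and set $a = \overline{s} - dp$. If $a > \underline{s}$ and $\overline{s} - 2dp < \underline{s}$, then $$\chi(S_r^{n-1}) \ge \frac{L}{M},$$ where $$L = \frac{m!}{l_1!\cdots l_t!},\qquad M = \sum_{(s_1,\dots,s_t)\in\mathcal{A}} \frac{m!}{s_1!\cdots s_t!},$$ $$\mathcal{A} = \{(s_1,\dots,s_t) : s_i \in \mathbb{Z}_{\ge 0},\ s_1+\dots+s_t = m,\ s_1 + 2s_2 + \dots + (t-1)s_{t-1} \le p-1\}.$$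
   Context: $S_r^{n-1} = \{x \in \mathbb{R}^n : \|x\|_2 = r\}$ is the Euclidean sphere of radius $r$ in $\mathbb{R}^n$; $\chi(S_r^{n-1})$ is the minimum number of colours needed to colour its points so that any two points at Euclidean distance exactly $1$ receive different colours. *)

theory Defs
  imports "HOL-Analysis.Analysis" "HOL-Number_Theory.Cong" "HOL-Computational_Algebra.Primes"
begin

definition unit_colourable :: "'a::metric_space set \<Rightarrow> nat \<Rightarrow> bool" where
  "unit_colourable S k \<longleftrightarrow>
     (\<exists>c :: 'a \<Rightarrow> nat. c ` S \<subseteq> {..<k} \<and> (\<forall>x\<in>S. \<forall>y\<in>S. dist x y = 1 \<longrightarrow> c x \<noteq> c y))"

text \<open>The minimum is meaningful only if some finite colouring exists, as it does for compact
  sets, hence for spheres (see \<open>compact_unit_colourable\<close>).\<close>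

definition unit_chromatic_number :: "'a::metric_space set \<Rightarrow> nat" where
  "unit_chromatic_number S = (LEAST k. unit_colourable S k)"

lemma compact_unit_colourable:
  fixes S :: "'a::metric_space set"
  assumes "compact S"
  shows "\<exists>k. unit_colourable S k"
proof -
  have "\<exists>F. finite F \<and> S \<subseteq> (\<Union>x\<in>F. ball x (1/2))"
    using assms unfolding compact_eq_totally_bounded by (meson half_gt_zero zero_less_one)
  then obtain F where F: "finite F" "S \<subseteq> (\<Union>x\<in>F. ball x (1/2))"
    by blast
  obtain k and f :: "'a \<Rightarrow> nat" where f: "f ` F = {i. i < k}" "inj_on f F"
    using finite_imp_inj_to_nat_seg[OF F(1)] by blast
  have "\<exists>z. z \<in> F \<and> dist z x < 1/2" if "x \<in> S" for x
    using F(2) that unfolding subset_eq UN_iff mem_ball by blast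
  then obtain g where g: "\<And>x. x \<in> S \<Longrightarrow> g x \<in> F \<and> dist (g x) x < 1/2"
    by metis
  have "f (g x) \<noteq> f (g y)" if "x \<in> S" "y \<in> S" "dist x y = 1" for x y
  proof
    assume "f (g x) = f (g y)"
    then have "g x = g y"
      using f(2) g that by (meson inj_onD)
    then show False
      using g[OF that(1)] g[OF that(2)] that(3) dist_triangle3[of x y "g x"] by simp
  qed
  moreover have "(\<lambda>x. f (g x)) ` S \<subseteq> {..<k}"
    using f(1) g by auto
  ultimately have "unit_colourable S k"
    unfolding unit_colourable_def by (intro exI[of _ "\<lambda>x. f (g x)"]) auto
  then show ?thesis ..
qed

text \<open>Integer vectors \<open>(x\<^sub>1, \<dots>, x\<^sub>m)\<close> are functions on \<open>{1..m}\<close>, extended by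
  \<open>undefined\<close> elsewhere so that each vector is represented exactly once.\<close>

definition prescribed_vectors ::
  "nat \<Rightarrow> nat \<Rightarrow> (nat \<Rightarrow> int) \<Rightarrow> (nat \<Rightarrow> nat) \<Rightarrow> (nat \<Rightarrow> int) set" where
  "prescribed_vectors m t b l =
     {x \<in> {1..m} \<rightarrow>\<^sub>E b ` {1..t}. \<forall>j\<in>{1..t}. card {i \<in> {1..m}. x i = b j} = l j}"

definition scalar_prod :: "nat \<Rightarrow> (nat \<Rightarrow> int) \<Rightarrow> (nat \<Rightarrow> int) \<Rightarrow> int" where
  "scalar_prod m x y = (\<Sum>i=1..m. x i * y i)"

definition multinomial :: "nat \<Rightarrow> nat \<Rightarrow> (nat \<Rightarrow> nat) \<Rightarrow> real" where
  "multinomial m t s = fact m / (\<Prod>j=1..t. fact (s j))"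

end

theory Submission
  imports Defs "HOL-Computational_Algebra.Polynomial"
begin

text \<open>
  All vectors of \<open>V\<close> have the same square \<open>s = s_max\<close>. Scaled by \<open>1 / sqrt (2dp)\<close> and lifted by
  one additional constant coordinate, \<open>V\<close> embeds into the sphere so that scalar product \<open>a = s - dp\<close>
  becomes distance 1; the choice of \<open>p\<close> makes the scaled radius at most \<open>r\<close>. Every colour class
  \<open>W\<close> thus avoids the scalar product \<open>a\<close>, and since all products lie in \<open>(s - 2dp, s]\<close>, distinct
  \<open>x, y \<in> W\<close> satisfy \<open>(x, y) / d \<noteq> s / d\<close> modulo \<open>p\<close>. The Frankl--Wilson polynomial method bounds
  \<open>|W|\<close>: the polynomials \<open>\<Prod>\<^sub>j ((x, y) / d - j)\<close> over the residues \<open>j \<noteq> s / d\<close> are linearly independent,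
  have degree at most \<open>p - 1\<close> in \<open>y\<close>, and each \<open>y\<^sub>i\<close> takes at most \<open>t\<close> values, so they lie in the span
  of the monomials of total degree at most \<open>p - 1\<close> with all exponents below \<open>t\<close>. There are \<open>M\<close> of these.
\<close>

section \<open>Counting functions by the sizes of their fibres\<close>

lemma sum_over_fibres:
  fixes h :: "'v \<Rightarrow> 'a::semiring_1"
  assumes "finite I" "finite J" "inj_on \<beta> J" "x ` I \<subseteq> \<beta> ` J"
  shows "(\<Sum>i\<in>I. h (x i)) = (\<Sum>j\<in>J. of_nat (card {i \<in> I. x i = \<beta> j}) * h (\<beta> j))"
proof -
  have "(\<Sum>i\<in>I. h (x i)) = (\<Sum>v\<in>\<beta> ` J. \<Sum>i\<in>{i \<in> I. x i = v}. h (x i))"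
    using assms by (intro sum.group[symmetric]) auto
  also have "\<dots> = (\<Sum>j\<in>J. \<Sum>i\<in>{i \<in> I. x i = \<beta> j}. h (x i))"
    using assms(3) by (simp add: sum.reindex)
  also have "\<dots> = (\<Sum>j\<in>J. of_nat (card {i \<in> I. x i = \<beta> j}) * h (\<beta> j))"
    by (intro sum.cong refl) simp
  finally show ?thesis .
qed

text \<open>Induction on \<open>I\<close>: choosing the value \<open>\<beta> j\<close> at a new
  point lowers \<open>l j\<close> by one, and the multinomial coefficients of the lowered vectors
  add up to the desired one because the \<open>l j\<close> sum to the new cardinality. It serves
  both for the size of \<open>V\<close> and for the terms of \<open>M\<close>.\<close>

lemma card_functions_with_fibre_sizes:
  assumes "finite I" "finite J" "inj_on \<beta> J" "(\<Sum>j\<in>J. l j) = card I"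
  shows "real (card {f \<in> I \<rightarrow>\<^sub>E \<beta> ` J. \<forall>j\<in>J. card {i \<in> I. f i = \<beta> j} = l j})
       = fact (card I) / (\<Prod>j\<in>J. fact (l j))"
  using assms(1,4)
proof (induction I arbitrary: l rule: finite_induct)
  case empty
  then have "\<forall>j\<in>J. l j = 0"
    using assms(2) by simp
  then have "{f \<in> {} \<rightarrow>\<^sub>E \<beta> ` J. \<forall>j\<in>J. card {i \<in> {}. f i = \<beta> j} = l j} = {\<lambda>_. undefined}"
    by auto
  with \<open>\<forall>j\<in>J. l j = 0\<close> show ?case
    by simp
next
  case (insert a I)
  define F where "F I l = {f \<in> I \<rightarrow>\<^sub>E \<beta> ` J. \<forall>j\<in>J. card {i \<in> I. f i = \<beta> j} = l j}" for I :: "'a set" and l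
  \<comment> \<open>For \<open>l j = 0\<close> the truncated \<open>l j - 1\<close> would leave the
    total at \<open>card I + 1\<close>, where the induction hypothesis does not apply.\<close>
  define J' where "J' = {j \<in> J. l j > 0}"
  define G where "G j = (\<lambda>f. f(a := \<beta> j)) ` F I (l(j := l j - 1))" for j
  have fib: "{i \<in> insert a I. f i = v} = (if f a = v then insert a else id) {i \<in> I. f i = v}" for f v
    by auto
  have cfib: "card {i \<in> insert a I. f i = v} = (if f a = v then 1 else 0) + card {i \<in> I. f i = v}" for f v
    using insert.hyps unfolding fib by (simp add: card_insert_if)
  have upd: "{i \<in> I. (f(a := w)) i = v} = {i \<in> I. f i = v}" for f v and w :: 'c
    using insert.hyps by auto
  have FU: "F (insert a I) l = (\<Union>j\<in>J'. G j)"
  proof (intro equalityI subsetI)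
    fix f assume f: "f \<in> F (insert a I) l"
    then obtain j where j: "j \<in> J" "f a = \<beta> j"
      unfolding F_def by auto
    have c: "card {i \<in> I. f i = \<beta> k} = (l(j := l j - 1)) k \<and> (k = j \<longrightarrow> l k > 0)" if "k \<in> J" for k
    proof -
      have "\<beta> j = \<beta> k \<longleftrightarrow> j = k" using inj_onD[OF assms(3)] j(1) that by blast
      then show ?thesis using f cfib[of f "\<beta> k"] that j(2) unfolding F_def by (auto split: if_splits)
    qed
    have f1: "f \<in> insert a I \<rightarrow>\<^sub>E \<beta> ` J" using f unfolding F_def by blast
    have "restrict f I \<in> F I (l(j := l j - 1))"
    proof -
      have "{i \<in> I. restrict f I i = v} = {i \<in> I. f i = v}" for v by auto
      then show ?thesis using f1 c unfolding F_def by auto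
    qed
    moreover have "f = (restrict f I)(a := \<beta> j)"
      using f1 j(2) by (auto simp: fun_eq_iff PiE_def extensional_def)
    ultimately have "f \<in> G j" unfolding G_def by blast
    then show "f \<in> (\<Union>j\<in>J'. G j)" using c j(1) unfolding J'_def by blast
  next
    fix f assume "f \<in> (\<Union>j\<in>J'. G j)"
    then obtain j g where j: "j \<in> J" "l j > 0" and g: "g \<in> F I (l(j := l j - 1))"
      and f: "f = g(a := \<beta> j)"
      unfolding G_def J'_def by blast
    have "card {i \<in> insert a I. f i = \<beta> k} = l k" if "k \<in> J" for k
    proof -
      have "\<beta> j = \<beta> k \<longleftrightarrow> j = k" using inj_onD[OF assms(3)] j(1) that by blast
      moreover have "card {i \<in> I. g i = \<beta> k} = (l(j := l j - 1)) k"
        using g that unfolding F_def by blast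
      ultimately show ?thesis using j(2) unfolding cfib unfolding f upd by (auto split: if_splits)
    qed
    moreover have "f \<in> insert a I \<rightarrow>\<^sub>E \<beta> ` J"
      using g j(1) unfolding F_def f by (intro PiE_fun_upd) auto
    ultimately show "f \<in> F (insert a I) l" unfolding F_def by blast
  qed
  have finF: "finite (F I l)" for l
    unfolding F_def using insert.hyps(1) assms(2) by (intro finite_subset[OF Collect_restrict finite_PiE]) auto
  have cG: "card (G j) = card (F I (l(j := l j - 1)))" for j
    unfolding G_def
  proof (rule card_image, rule inj_onI)
    fix f g assume fg: "f \<in> F I (l(j := l j - 1))" "g \<in> F I (l(j := l j - 1))" "f(a := \<beta> j) = g(a := \<beta> j)"
    \<comment> \<open>Extensionality fixes the value at \<open>a\<close> before the update, so
      updating at \<open>a\<close> is injective.\<close>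
    have "h a = undefined" if "h \<in> F I l" for h l
      using that insert.hyps(2) unfolding F_def by (blast intro: PiE_arb)
    then have "f a = g a" using fg(1,2) by metis
    then show "f = g" using fg(3) by (metis fun_upd_triv fun_upd_upd)
  qed
  have "card (F (insert a I) l) = (\<Sum>j\<in>J'. card (G j))"
    unfolding FU
  proof (rule card_UN_disjoint)
    show "finite J'" using assms(2) unfolding J'_def by simp
    show "\<forall>j\<in>J'. finite (G j)" unfolding G_def using finF by blast
    show "\<forall>j\<in>J'. \<forall>k\<in>J'. j \<noteq> k \<longrightarrow> G j \<inter> G k = {}"
    proof (intro ballI impI)
      fix j k assume jk: "j \<in> J'" "k \<in> J'" "j \<noteq> k"
      then have "\<beta> j \<noteq> \<beta> k" using inj_onD[OF assms(3)] unfolding J'_def by blast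
      moreover have "f a = \<beta> j" if "f \<in> G j" for f j using that unfolding G_def by auto
      ultimately show "G j \<inter> G k = {}" by force
    qed
  qed
  then have "real (card (F (insert a I) l)) = (\<Sum>j\<in>J'. real (card (F I (l(j := l j - 1)))))"
    by (simp add: cG)
  also have "\<dots> = (\<Sum>j\<in>J'. real (l j) * fact (card I) / (\<Prod>k\<in>J. fact (l k)))"
  proof (intro sum.cong refl)
    fix j assume "j \<in> J'"
    then have j: "j \<in> J" "l j > 0" unfolding J'_def by auto
    have s: "sum (l(j := l j - 1)) J = card I"
    proof -
      have "sum (l(j := l j - 1)) J = (l j - 1) + sum l (J - {j})"
        using j assms(2) by (simp add: sum.remove)
      also have "\<dots> = sum l J - 1" using j assms(2) by (simp add: sum.remove)
      also have "\<dots> = card I" using insert by simp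
      finally show ?thesis .
    qed
    have p: "(\<Prod>k\<in>J. fact (l k) :: real) = real (l j) * (\<Prod>k\<in>J. fact ((l(j := l j - 1)) k))"
    proof -
      have "(fact (l j) :: real) = real (l j) * fact (l j - 1)"
        using j(2) by (simp add: fact_reduce)
      moreover have "(\<Prod>k\<in>J. fact ((l(j := l j - 1)) k) :: real) = fact (l j - 1) * (\<Prod>k\<in>J - {j}. fact (l k))"
        using j assms(2) by (simp add: prod.remove)
      ultimately show ?thesis using prod.remove[OF assms(2) j(1), of "\<lambda>k. fact (l k) :: real"] by simp
    qed
    show "real (card (F I (l(j := l j - 1)))) = real (l j) * fact (card I) / (\<Prod>k\<in>J. fact (l k))"
      unfolding p using insert.IH[OF s] j(2) unfolding F_def by simp
  qed
  also have "\<dots> = (\<Sum>j\<in>J'. real (l j)) * fact (card I) / (\<Prod>k\<in>J. fact (l k))"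
    by (simp add: sum_distrib_right sum_divide_distrib)
  also have "(\<Sum>j\<in>J'. real (l j)) = (\<Sum>j\<in>J. real (l j))"
    unfolding J'_def using assms(2) by (intro sum.mono_neutral_left) auto
  also have "\<dots> = real (card (insert a I))"
    using insert.prems by (metis of_nat_sum)
  finally show ?case
    using insert.hyps unfolding F_def by (simp add: algebra_simps)
qed

section \<open>Linear relations and their primitive integer multiples\<close>

text \<open>Gaussian elimination: an equation with a nonzero coefficient removes itself and one
  unknown, so unknowns stay in the majority; an equation with only zero coefficients imposes
  nothing.\<close>

lemma homogeneous_system_nontrivial_solution:
  fixes c :: "'w \<Rightarrow> 'e \<Rightarrow> 'a::field"
  assumes "finite E" "finite W" "card E < card W"
  shows "\<exists>u. (\<exists>x\<in>W. u x \<noteq> 0) \<and> (\<forall>e\<in>E. (\<Sum>x\<in>W. u x * c x e) = 0)"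
  using assms
proof (induction E arbitrary: W c rule: finite_induct)
  case empty
  then obtain x where "x \<in> W" by fastforce
  then show ?case by (intro exI[of _ "\<lambda>_. 1"]) auto
next
  case (insert e E)
  show ?case
  proof (cases "\<forall>x\<in>W. c x e = 0")
    case True
    then show ?thesis using insert.IH[of W c] insert by auto
  next
    case False
    then obtain z where z: "z \<in> W" "c z e \<noteq> 0" by blast
    \<comment> \<open>Coefficients after solving equation \<open>e\<close> for the unknown at the
      pivot \<open>z\<close> and substituting.\<close>
    let ?c = "\<lambda>x f. c x f - c x e / c z e * c z f"
    have "card E < card (W - {z})" using insert z by simp
    then obtain u where u: "\<exists>x\<in>W - {z}. u x \<noteq> 0" "\<forall>f\<in>E. (\<Sum>x\<in>W - {z}. u x * ?c x f) = 0"
      using insert.IH[of "W - {z}" ?c] insert.prems by auto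
    \<comment> \<open>Back substitution: equation \<open>e\<close> forces the value at
      \<open>z\<close>.\<close>
    define v where "v = u(z := - (\<Sum>x\<in>W - {z}. u x * c x e) / c z e)"
    have split: "(\<Sum>x\<in>W. v x * c x f) = v z * c z f + (\<Sum>x\<in>W - {z}. u x * c x f)" for f
      using insert.prems(1) z(1) by (simp add: sum.remove v_def)
    have "(\<Sum>x\<in>W. v x * c x e) = 0"
      unfolding split using z(2) by (simp add: v_def)
    moreover have "(\<Sum>x\<in>W. v x * c x f) = 0" if "f \<in> E" for f
    proof -
      have "0 = (\<Sum>x\<in>W - {z}. u x * ?c x f)" using u(2) that by simp
      also have "\<dots> = (\<Sum>x\<in>W - {z}. u x * c x f) - (\<Sum>x\<in>W - {z}. u x * c x e) / c z e * c z f"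
        by (simp add: algebra_simps sum_subtractf sum_distrib_left sum_divide_distrib)
      finally show ?thesis unfolding split by (simp add: v_def)
    qed
    moreover have "\<exists>x\<in>W. v x \<noteq> 0" using u(1) unfolding v_def by auto
    ultimately show ?thesis by blast
  qed
qed

text \<open>Clear denominators, then divide by the gcd. A rational linear relation can thus be read
  modulo a prime without all its coefficients vanishing.\<close>

lemma rational_family_primitive_multiple:
  fixes u :: "'w \<Rightarrow> rat" and p :: int
  assumes "finite W" "x \<in> W" "u x \<noteq> 0" "\<not> is_unit p"
  shows "\<exists>q v. (\<forall>x\<in>W. of_int (v x) = q * u x) \<and> (\<exists>x\<in>W. \<not> p dvd v x)"
proof -
  define D where "D x = snd (quotient_of (u x))" for x
  have D: "D x > 0" "u x * of_int (D x) = of_int (fst (quotient_of (u x)))" for x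
    using quotient_of_denom_pos'[of "u x"] quotient_of_div[of "u x" "fst (quotient_of (u x))" "D x"]
    unfolding D_def by (auto simp: field_simps)
  \<comment> \<open>This is \<open>u x\<close> times the product of all denominators, with the
    denominator of \<open>u x\<close> already cancelled so that it is visibly an integer.\<close>
  define z where "z x = fst (quotient_of (u x)) * (\<Prod>y\<in>W - {x}. D y)" for x
  have z: "of_int (z x) = of_int (\<Prod>y\<in>W. D y) * u x" if "x \<in> W" for x
    unfolding z_def of_int_mult D(2)[symmetric] prod.remove[OF assms(1) that] by simp
  define g where "g = Gcd (z ` W)"
  have "(\<Prod>y\<in>W. D y) \<noteq> 0" using D(1) assms(1) by (simp add: less_imp_neq[symmetric])
  then have "of_int (z x) \<noteq> (0::rat)" unfolding z[OF assms(2)] using assms(3) by (simp del: of_int_prod)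
  then have "z x \<noteq> 0" by simp
  then have g0: "g \<noteq> 0" using assms(2) unfolding g_def by auto
  have gz: "g dvd z x" if "x \<in> W" for x using that unfolding g_def by simp
  have "\<exists>x\<in>W. \<not> p dvd z x div g"
  proof (rule ccontr)
    assume "\<not> ?thesis"
    then have "g * p dvd z x" if "x \<in> W" for x
      using gz[OF that] g0 that by (metis dvd_div_iff_mult mult.commute)
    then have "g * p dvd g" unfolding g_def by (metis Gcd_greatest imageE)
    then show False using g0 assms(4) by auto
  qed
  moreover have "\<forall>x\<in>W. of_int (z x div g) = of_int (\<Prod>y\<in>W. D y) / of_int g * u x"
    using z gz g0 by (simp add: of_int_div field_simps del: of_int_prod)
  ultimately show ?thesis by (intro exI conjI)
qed

section \<open>Polynomial functions on a finite grid and their reduced monomials\<close>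

definition reduced_exponents :: "'i set \<Rightarrow> nat \<Rightarrow> nat \<Rightarrow> ('i \<Rightarrow> nat) set" where
  "reduced_exponents I t k = {e \<in> I \<rightarrow>\<^sub>E {..<t}. (\<Sum>i\<in>I. e i) \<le> k}"

text \<open>Agreement is demanded only on the grid, so high powers of a coordinate may be rewritten
  by relations that hold on \<open>B\<close>.\<close>

definition reduced_poly_on :: "'i set \<Rightarrow> 'a set \<Rightarrow> nat \<Rightarrow> (('i \<Rightarrow> 'a::field) \<Rightarrow> 'a) \<Rightarrow> bool" where
  "reduced_poly_on I B k f \<longleftrightarrow>
     (\<exists>c. \<forall>y\<in>I \<rightarrow> B. f y = (\<Sum>e\<in>reduced_exponents I (card B) k. c e * (\<Prod>i\<in>I. y i ^ e i)))"

lemma finite_reduced_exponents: "finite I \<Longrightarrow> finite (reduced_exponents I t k)"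
  unfolding reduced_exponents_def by (rule finite_subset[OF Collect_restrict finite_PiE]) auto

lemma reduced_poly_on_cong:
  "reduced_poly_on I B k f \<Longrightarrow> (\<And>y. y \<in> I \<rightarrow> B \<Longrightarrow> f y = g y) \<Longrightarrow> reduced_poly_on I B k g"
  unfolding reduced_poly_on_def by simp

lemma reduced_poly_on_0: "reduced_poly_on I B k (\<lambda>_. 0)"
  unfolding reduced_poly_on_def by (rule exI[of _ "\<lambda>_. 0"]) simp

lemma reduced_poly_on_add:
  "reduced_poly_on I B k f \<Longrightarrow> reduced_poly_on I B k g \<Longrightarrow> reduced_poly_on I B k (\<lambda>y. f y + g y)"
  unfolding reduced_poly_on_def
proof (elim exE)
  fix c d
  assume "\<forall>y\<in>I \<rightarrow> B. f y = (\<Sum>e\<in>reduced_exponents I (card B) k. c e * (\<Prod>i\<in>I. y i ^ e i))"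
    "\<forall>y\<in>I \<rightarrow> B. g y = (\<Sum>e\<in>reduced_exponents I (card B) k. d e * (\<Prod>i\<in>I. y i ^ e i))"
  then show "\<exists>c. \<forall>y\<in>I \<rightarrow> B. f y + g y = (\<Sum>e\<in>reduced_exponents I (card B) k. c e * (\<Prod>i\<in>I. y i ^ e i))"
    by (intro exI[of _ "\<lambda>e. c e + d e"]) (simp add: distrib_right sum.distrib)
qed

lemma reduced_poly_on_cmult:
  "reduced_poly_on I B k f \<Longrightarrow> reduced_poly_on I B k (\<lambda>y. a * f y)"
  unfolding reduced_poly_on_def
proof (elim exE)
  fix c
  assume "\<forall>y\<in>I \<rightarrow> B. f y = (\<Sum>e\<in>reduced_exponents I (card B) k. c e * (\<Prod>i\<in>I. y i ^ e i))"
  then show "\<exists>c. \<forall>y\<in>I \<rightarrow> B. a * f y = (\<Sum>e\<in>reduced_exponents I (card B) k. c e * (\<Prod>i\<in>I. y i ^ e i))"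
    by (intro exI[of _ "\<lambda>e. a * c e"]) (simp add: sum_distrib_left mult.assoc)
qed

lemma reduced_poly_on_sum:
  assumes "\<And>x. x \<in> X \<Longrightarrow> reduced_poly_on I B k (f x)"
  shows "reduced_poly_on I B k (\<lambda>y. \<Sum>x\<in>X. f x y)"
  using assms
  by (induction X rule: infinite_finite_induct) (simp_all add: reduced_poly_on_0 reduced_poly_on_add)

lemma reduced_poly_on_monomial:
  assumes "finite I" "e \<in> reduced_exponents I (card B) k"
  shows "reduced_poly_on I B k (\<lambda>y. \<Prod>i\<in>I. y i ^ e i)"
  unfolding reduced_poly_on_def
  using assms finite_reduced_exponents[OF assms(1), of "card B" k]
  by (intro exI[of _ "\<lambda>e'. if e' = e then 1 else 0"]) (simp add: if_distrib[of "\<lambda>z. z * _"] cong: if_cong)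

text \<open>The constant monomial has all exponents \<open>0\<close>, which must lie below
  \<open>card B\<close>.\<close>

lemma reduced_poly_on_1:
  assumes "finite I" "card B > 0"
  shows "reduced_poly_on I B k (\<lambda>_. 1)"
proof -
  have "restrict (\<lambda>_. 0) I \<in> reduced_exponents I (card B) k"
    using assms unfolding reduced_exponents_def by auto
  from reduced_poly_on_monomial[OF assms(1) this] show ?thesis
    by simp
qed

lemma reduced_poly_on_mono:
  assumes "finite I" "reduced_poly_on I B k f" "k \<le> k'"
  shows "reduced_poly_on I B k' f"
proof -
  obtain c where c: "\<And>y. y \<in> I \<rightarrow> B \<Longrightarrow> f y = (\<Sum>e\<in>reduced_exponents I (card B) k. c e * (\<Prod>i\<in>I. y i ^ e i))"
    using assms(2) unfolding reduced_poly_on_def by blast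
  have "reduced_exponents I (card B) k \<subseteq> reduced_exponents I (card B) k'"
    using assms(3) unfolding reduced_exponents_def by auto
  then have "reduced_poly_on I B k' (\<lambda>y. \<Sum>e\<in>reduced_exponents I (card B) k. c e * (\<Prod>i\<in>I. y i ^ e i))"
    using assms(1) by (intro reduced_poly_on_sum reduced_poly_on_cmult reduced_poly_on_monomial) auto
  then show ?thesis by (rule reduced_poly_on_cong) (simp add: c)
qed

text \<open>The monic polynomial with root set \<open>B\<close> vanishes on \<open>B\<close>, so its
  leading power equals minus its lower terms there.\<close>

lemma power_card_eq_lower_powers:
  fixes B :: "'a::field set"
  assumes "finite B"
  shows "\<exists>q. \<forall>v\<in>B. v ^ card B = (\<Sum>j<card B. q j * v ^ j)"
proof -
  define P where "P = (\<Prod>b\<in>B. [:- b, 1:])"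
  have deg: "degree P = card B"
    unfolding P_def by (subst degree_prod_eq_sum_degree) auto
  moreover have "lead_coeff P = 1"
    unfolding P_def by (simp add: lead_coeff_prod)
  ultimately have lc: "coeff P (card B) = 1" by simp
  have "v ^ card B = (\<Sum>j<card B. - coeff P j * v ^ j)" if "v \<in> B" for v
  proof -
    have "0 = poly P v" using that assms unfolding P_def by (auto simp: poly_prod)
    also have "\<dots> = (\<Sum>j<card B. coeff P j * v ^ j) + v ^ card B"
      unfolding poly_altdef deg using lc by (simp add: lessThan_Suc_atMost[symmetric])
    finally show ?thesis by (simp add: sum_negf eq_neg_iff_add_eq_0 add.commute)
  qed
  then show ?thesis by (intro exI[of _ "\<lambda>j. - coeff P j"]) simp
qed

text \<open>By linearity a single monomial suffices. If the raised exponent of \<open>y a\<close>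
  reaches \<open>card B\<close>, it is replaced by lower powers, which cannot increase the
  degree.\<close>

lemma reduced_poly_on_mult_var:
  assumes "finite I" "finite B" "a \<in> I" "reduced_poly_on I B k f"
  shows "reduced_poly_on I B (Suc k) (\<lambda>y. y a * f y)"
proof -
  have mon: "reduced_poly_on I B (Suc k) (\<lambda>y. y a * (\<Prod>i\<in>I. y i ^ e i))"
    if e: "e \<in> reduced_exponents I (card B) k" for e
  proof -
    have ee: "e \<in> I \<rightarrow>\<^sub>E {..<card B}" "sum e I \<le> k"
      using e unfolding reduced_exponents_def by auto
    have upd: "(\<Prod>i\<in>I. y i ^ (e(a := j)) i) = y a ^ j * (\<Prod>i\<in>I - {a}. y i ^ e i)" for y :: "'a \<Rightarrow> 'b" and j
      using assms(1,3) by (simp add: prod.remove)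
    have var: "y a * (\<Prod>i\<in>I. y i ^ e i) = y a ^ Suc (e a) * (\<Prod>i\<in>I - {a}. y i ^ e i)" for y :: "'a \<Rightarrow> 'b"
      using assms(1,3) by (simp add: prod.remove)
    \<comment> \<open>Covers both cases below: the raised exponent itself and the lower powers that
      replace it.\<close>
    have inE: "e(a := j) \<in> reduced_exponents I (card B) (Suc k)" if "j < card B" "j \<le> Suc (e a)" for j
    proof -
      have "e(a := j) \<in> I \<rightarrow>\<^sub>E {..<card B}"
        using ee(1) assms(3) that(1) by (auto simp: PiE_def extensional_def)
      moreover have "sum (e(a := j)) I \<le> Suc (sum e I)"
        using assms(1,3) that(2) by (simp add: sum.remove)
      ultimately show ?thesis using ee(2) unfolding reduced_exponents_def by auto
    qed
    show ?thesis
    proof (cases "Suc (e a) < card B")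
      case True
      from reduced_poly_on_monomial[OF assms(1) inE[OF True order_refl]]
      show ?thesis by (rule reduced_poly_on_cong) (simp only: upd var)
    next
      case False
      then have ea: "Suc (e a) = card B" using PiE_mem[OF ee(1) assms(3)] by simp
      obtain q where q: "\<And>v. v \<in> B \<Longrightarrow> v ^ card B = (\<Sum>j<card B. q j * v ^ j)"
        using power_card_eq_lower_powers[OF assms(2)] by blast
      have "reduced_poly_on I B (Suc k) (\<lambda>y. \<Sum>j<card B. q j * (\<Prod>i\<in>I. y i ^ (e(a := j)) i))"
        using ea by (intro reduced_poly_on_sum reduced_poly_on_cmult reduced_poly_on_monomial[OF assms(1)] inE) auto
      then show ?thesis
      proof (rule reduced_poly_on_cong)
        fix y :: "'a \<Rightarrow> 'b" assume "y \<in> I \<rightarrow> B"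
        then have "y a \<in> B" using assms(3) by auto
        then show "(\<Sum>j<card B. q j * (\<Prod>i\<in>I. y i ^ (e(a := j)) i)) = y a * (\<Prod>i\<in>I. y i ^ e i)"
          unfolding upd var ea q[OF \<open>y a \<in> B\<close>] by (simp add: sum_distrib_right mult.assoc)
      qed
    qed
  qed
  obtain c where c: "\<And>y. y \<in> I \<rightarrow> B \<Longrightarrow> f y = (\<Sum>e\<in>reduced_exponents I (card B) k. c e * (\<Prod>i\<in>I. y i ^ e i))"
    using assms(4) unfolding reduced_poly_on_def by blast
  have "reduced_poly_on I B (Suc k)
      (\<lambda>y. \<Sum>e\<in>reduced_exponents I (card B) k. c e * (y a * (\<Prod>i\<in>I. y i ^ e i)))"
    by (intro reduced_poly_on_sum reduced_poly_on_cmult mon)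
  then show ?thesis
    by (rule reduced_poly_on_cong) (simp add: c sum_distrib_left mult_ac)
qed

lemma reduced_poly_on_prod_affine:
  assumes "finite I" "finite B" "card B > 0" "finite J"
  shows "reduced_poly_on I B (card J) (\<lambda>y. \<Prod>j\<in>J. (\<Sum>i\<in>I. u i * y i) + w j)"
  using assms(4)
proof (induction J rule: finite_induct)
  case empty
  then show ?case using reduced_poly_on_1[OF assms(1,3), of 0] by simp
next
  case (insert a J)
  let ?f = "\<lambda>y. \<Prod>j\<in>J. (\<Sum>i\<in>I. u i * y i) + w j"
  have "reduced_poly_on I B (Suc (card J)) (\<lambda>y. (\<Sum>i\<in>I. u i * (y i * ?f y)) + w a * ?f y)"
    using insert.IH assms
    by (intro reduced_poly_on_add reduced_poly_on_sum reduced_poly_on_cmult reduced_poly_on_mult_var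
        reduced_poly_on_mono[OF assms(1) insert.IH]) auto
  then show ?case
    using insert.hyps by (simp add: distrib_right sum_distrib_right mult.assoc)
qed

section \<open>The polynomial method modulo a prime\<close>

text \<open>Modulo \<open>p\<close> the matrix \<open>P x y\<close> is diagonal with nonzero
  diagonal. If \<open>W\<close> outnumbered the reduced monomials, the functions \<open>P x\<close>
  would satisfy a rational relation on \<open>W\<close>; its primitive integer multiple, evaluated
  at a point whose coefficient is prime to \<open>p\<close>, gives a contradiction. Working over the
  rationals permits the division by \<open>d\<close>.\<close>

lemma card_le_of_scalar_products_mod_prime:
  fixes W :: "('i \<Rightarrow> int) set" and d \<kappa> :: int and p :: nat
  assumes "finite I" "finite B" "B \<noteq> {}" "finite W" "W \<subseteq> I \<rightarrow> B" "d \<noteq> 0" "prime p"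
    and dvd: "\<And>x y. x \<in> W \<Longrightarrow> y \<in> W \<Longrightarrow> d dvd (\<Sum>i\<in>I. x i * y i)"
    and diag: "\<And>x. x \<in> W \<Longrightarrow> [(\<Sum>i\<in>I. x i * x i) div d = \<kappa>] (mod int p)"
    and off_diag: "\<And>x y. x \<in> W \<Longrightarrow> y \<in> W \<Longrightarrow> x \<noteq> y \<Longrightarrow>
      \<not> [(\<Sum>i\<in>I. x i * y i) div d = \<kappa>] (mod int p)"
  shows "card W \<le> card (reduced_exponents I (card B) (p - 1))"
proof (rule ccontr)
  let ?E = "reduced_exponents I (card B) (p - 1)"
  assume "\<not> card W \<le> card ?E"
  then have less: "card ?E < card W" by simp
  define z where "z x y = (\<Sum>i\<in>I. x i * y i) div d" for x y :: "'i \<Rightarrow> int"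
  \<comment> \<open>All residues except that of \<open>\<kappa>\<close>: exactly
    \<open>p - 1\<close> factors, whose product is divisible by \<open>p\<close> unless
    \<open>z x y\<close> is congruent to \<open>\<kappa>\<close>.\<close>
  define J where "J = {0..<int p} - {\<kappa> mod int p}"
  define P where "P x y = (\<Prod>j\<in>J. z x y - j)" for x y
  have p0: "int p > 0" and pp: "prime (int p)"
    using assms(7) prime_gt_0_nat by auto
  have cardJ: "card J = p - 1" and finJ: "finite J"
    using p0 unfolding J_def by (simp_all add: card_Diff_singleton)
  have P_diag: "\<not> int p dvd P x x" if "x \<in> W" for x
  proof
    assume "int p dvd P x x"
    then obtain j where j: "j \<in> J" "int p dvd z x x - j"
      using pp finJ unfolding P_def by (auto simp: prime_dvd_prod_iff)
    then have "j mod int p = \<kappa> mod int p"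
      using diag[OF that] unfolding z_def cong_def by (metis mod_eq_dvd_iff)
    then show False using j(1) unfolding J_def by auto
  qed
  have P_off: "int p dvd P x y" if "x \<in> W" "y \<in> W" "x \<noteq> y" for x y
  proof -
    have "z x y mod int p \<in> J"
      using off_diag[OF that] p0 unfolding J_def z_def cong_def by auto
    moreover have "int p dvd z x y - z x y mod int p"
      by (simp add: minus_mod_eq_mult_div)
    ultimately show ?thesis
      unfolding P_def by (meson dvd_prodI dvd_trans finJ)
  qed
  have "\<exists>c. \<forall>y\<in>W. of_int (P x y) = (\<Sum>e\<in>?E. c e * (\<Prod>i\<in>I. of_int (y i) ^ e i) :: rat)"
    if x: "x \<in> W" for x
  proof -
    have cB: "card (of_int ` B :: rat set) = card B"
      by (intro card_image) (simp add: inj_on_def)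
    have "reduced_poly_on I (of_int ` B :: rat set) (p - 1)
        (\<lambda>y. \<Prod>j\<in>J. (\<Sum>i\<in>I. of_int (x i) / of_int d * y i) + - of_int j)"
      unfolding cardJ[symmetric] using assms(1-3) finJ
      by (intro reduced_poly_on_prod_affine) (auto simp: cB card_gt_0_iff)
    then obtain c where c: "\<And>y. y \<in> I \<rightarrow> of_int ` B \<Longrightarrow>
        (\<Prod>j\<in>J. (\<Sum>i\<in>I. of_int (x i) / of_int d * y i) + - of_int j)
        = (\<Sum>e\<in>?E. c e * (\<Prod>i\<in>I. y i ^ e i) :: rat)"
      unfolding reduced_poly_on_def cB by blast
    have "of_int (P x y) = (\<Sum>e\<in>?E. c e * (\<Prod>i\<in>I. of_int (y i) ^ e i))" if y: "y \<in> W" for y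
    proof -
      have "of_int (z x y) = (\<Sum>i\<in>I. of_int (x i) / of_int d * of_int (y i) :: rat)"
        using dvd[OF x y] assms(6) unfolding z_def
        by (simp add: of_int_div sum_divide_distrib)
      then have "of_int (P x y) = (\<Prod>j\<in>J. (\<Sum>i\<in>I. of_int (x i) / of_int d * of_int (y i)) + - of_int j :: rat)"
        unfolding P_def by simp
      also have "\<dots> = (\<Sum>e\<in>?E. c e * (\<Prod>i\<in>I. of_int (y i) ^ e i))"
        using y assms(5) by (intro c) auto
      finally show ?thesis .
    qed
    then show ?thesis by (intro exI ballI)
  qed
  then obtain c where c: "\<And>x y. x \<in> W \<Longrightarrow> y \<in> W \<Longrightarrow>
      of_int (P x y) = (\<Sum>e\<in>?E. c x e * (\<Prod>i\<in>I. of_int (y i) ^ e i) :: rat)"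
    by metis
  obtain u x1 where u: "x1 \<in> W" "u x1 \<noteq> 0" "\<And>e. e \<in> ?E \<Longrightarrow> (\<Sum>x\<in>W. u x * c x e) = 0"
    using homogeneous_system_nontrivial_solution[OF finite_reduced_exponents[OF assms(1)] assms(4) less, of c]
    by metis
  obtain q v x0 where v: "\<And>x. x \<in> W \<Longrightarrow> of_int (v x) = q * u x" and x0: "x0 \<in> W" "\<not> int p dvd v x0"
    using rational_family_primitive_multiple[where u = u and p = "int p", OF assms(4) u(1,2)] pp
    by (meson not_prime_unit)
  have "of_int (\<Sum>x\<in>W. v x * P x x0) = (\<Sum>x\<in>W. \<Sum>e\<in>?E. q * (\<Prod>i\<in>I. of_int (x0 i) ^ e i) * (u x * c x e))"
    using x0(1) by (simp add: v c sum_distrib_left mult_ac)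
  also have "\<dots> = (\<Sum>e\<in>?E. q * (\<Prod>i\<in>I. of_int (x0 i) ^ e i) * (\<Sum>x\<in>W. u x * c x e))"
    unfolding sum_distrib_left by (rule sum.swap)
  also have "\<dots> = 0"
    using u(3) by simp
  finally have "(\<Sum>x\<in>W. v x * P x x0) = 0"
    by (simp only: of_int_eq_0_iff)
  \<comment> \<open>All terms off the diagonal are divisible by \<open>p\<close>, so the isolated
    diagonal term must be as well.\<close>
  then have "v x0 * P x0 x0 = - (\<Sum>x\<in>W - {x0}. v x * P x x0)"
    using x0(1) assms(4) by (simp add: sum.remove)
  moreover have "int p dvd (\<Sum>x\<in>W - {x0}. v x * P x x0)"
    using P_off x0(1) by (intro dvd_sum dvd_mult) auto
  ultimately have "int p dvd v x0 * P x0 x0" by simp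
  then show False
    using x0 P_diag pp by (simp add: prime_dvd_mult_iff)
qed

section \<open>Colour classes and embedding into a sphere\<close>

text \<open>The colour classes of an optimal colouring, pulled back along \<open>\<phi>\<close>,
  cover \<open>V\<close>, and each avoids distance 1.\<close>

lemma card_le_chromatic_number_mult_independence:
  fixes \<phi> :: "'v \<Rightarrow> 'a::metric_space"
  assumes "compact S" "finite V" "\<phi> ` V \<subseteq> S"
    and "\<And>W. W \<subseteq> V \<Longrightarrow> \<forall>x\<in>W. \<forall>y\<in>W. dist (\<phi> x) (\<phi> y) \<noteq> 1 \<Longrightarrow> card W \<le> N"
  shows "card V \<le> unit_chromatic_number S * N"
proof -
  let ?k = "unit_chromatic_number S"
  \<comment> \<open>Compactness supplies a finite colouring, so the least number of colours is
    attained.\<close>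
  have "unit_colourable S ?k"
    unfolding unit_chromatic_number_def using compact_unit_colourable[OF assms(1)] by (rule LeastI_ex)
  then obtain c where c: "c ` S \<subseteq> {..<?k}" "\<forall>x\<in>S. \<forall>y\<in>S. dist x y = 1 \<longrightarrow> c x \<noteq> c y"
    unfolding unit_colourable_def by blast
  have V: "V = (\<Union>j<?k. {x \<in> V. c (\<phi> x) = j})"
    using c(1) assms(3) by (auto simp: image_subset_iff)
  have "card V \<le> (\<Sum>j<?k. card {x \<in> V. c (\<phi> x) = j})"
    by (subst V) (rule card_UN_le[OF finite_lessThan])
  also have "\<dots> \<le> (\<Sum>j<?k. N)"
  proof (intro sum_mono assms(4) ballI)
    fix j x y
    assume "x \<in> {x \<in> V. c (\<phi> x) = j}" "y \<in> {x \<in> V. c (\<phi> x) = j}"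
    then have "\<phi> x \<in> S" "\<phi> y \<in> S" "c (\<phi> x) = c (\<phi> y)"
      using assms(3) by auto
    then show "dist (\<phi> x) (\<phi> y) \<noteq> 1"
      using c(2) by blast
  qed auto
  finally show ?thesis by simp
qed

text \<open>Coordinate \<open>0\<close> holds the constant \<open>h\<close>, coordinates
  \<open>1\<close> to \<open>m\<close> hold \<open>x\<close>, and the rest are zero. The constant
  later raises the radius to exactly \<open>r\<close> without changing distances.\<close>

lemma vec_with_prescribed_inner_products:
  assumes "m < CARD('n::finite)"
  shows "\<exists>E :: (nat \<Rightarrow> real) \<Rightarrow> real ^ 'n. \<forall>x y. E x \<bullet> E y = h * h + (\<Sum>i=1..m. x i * y i)"
proof -
  obtain g :: "'n \<Rightarrow> nat" where g: "bij_betw g UNIV {0..<CARD('n)}"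
    using ex_bij_betw_finite_nat[of "UNIV :: 'n set"] by auto
  define w where "w x j = (if j = 0 then h else if j \<le> m then x j else 0)" for x :: "nat \<Rightarrow> real" and j
  define E :: "(nat \<Rightarrow> real) \<Rightarrow> real ^ 'n" where "E x = (\<chi> k. w x (g k))" for x
  have "E x \<bullet> E y = h * h + (\<Sum>i=1..m. x i * y i)" for x y
  proof -
    have "E x \<bullet> E y = (\<Sum>k\<in>UNIV. w x (g k) * w y (g k))"
      unfolding E_def inner_vec_def by simp
    also have "\<dots> = (\<Sum>j\<in>{0..<CARD('n)}. w x j * w y j)"
      by (rule sum.reindex_bij_betw[OF g])
    also have "\<dots> = (\<Sum>j\<in>insert 0 {1..m}. w x j * w y j)"
      using assms by (intro sum.mono_neutral_right) (auto simp: w_def)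
    also have "\<dots> = h * h + (\<Sum>i=1..m. x i * y i)"
      by (simp add: w_def)
    finally show ?thesis .
  qed
  then show ?thesis by blast
qed

section \<open>Evaluating \<open>L\<close> and bounding the number of monomials by
  \<open>M\<close>\<close>

lemma card_prescribed_vectors:
  assumes "inj_on b {1..t}" "(\<Sum>j=1..t. l j) = m"
  shows "real (card (prescribed_vectors m t b l)) = multinomial m t l"
  using card_functions_with_fibre_sizes[OF _ _ assms(1), of "{1..m}" l] assms(2)
  unfolding prescribed_vectors_def multinomial_def by simp

text \<open>The exponents \<open>0, \<dots>, t - 1\<close> are written as \<open>j mod t\<close> with \<open>j \<in> {1..t}\<close>: the index \<open>t\<close>
  of \<open>s\<close> counts the variables that do not occur in the monomial.\<close>

lemma card_reduced_exponents_le: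
  assumes "t > 0"
  shows "real (card (reduced_exponents {1..m} t k))
    \<le> (\<Sum>s\<in>{s \<in> {1..t} \<rightarrow>\<^sub>E UNIV. (\<Sum>i=1..t. s i) = m \<and> (\<Sum>i=1..<t. i * s i) \<le> k}. multinomial m t s)"
    (is "_ \<le> sum _ ?A")
proof -
  define \<beta> where "\<beta> j = j mod t" for j
  have t: "{1..t} = insert t {1..<t}"
    using assms by auto
  have inj: "inj_on \<beta> {1..t}"
    unfolding t \<beta>_def by (auto simp: inj_on_def)
  have img: "\<beta> ` {1..t} = {..<t}"
    unfolding t \<beta>_def using assms by (force simp: image_iff)
  define F where "F s = {e \<in> {1..m} \<rightarrow>\<^sub>E \<beta> ` {1..t}. \<forall>j\<in>{1..t}. card {i \<in> {1..m}. e i = \<beta> j} = s j}" for s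
  have "?A \<subseteq> {1..t} \<rightarrow>\<^sub>E {0..m}"
  proof
    fix s assume s: "s \<in> ?A"
    then have "s j \<le> m" if "j \<in> {1..t}" for j
      using member_le_sum[of j "{1..t}" s] that by simp
    then show "s \<in> {1..t} \<rightarrow>\<^sub>E {0..m}"
      using s by (auto simp: PiE_def)
  qed
  then have finA: "finite ?A"
    by (rule finite_subset) (intro finite_PiE; simp)
  have cardF: "real (card (F s)) = multinomial m t s" if "s \<in> ?A" for s
    using card_functions_with_fibre_sizes[OF _ _ inj, of "{1..m}" s] that
    unfolding F_def multinomial_def by simp
  have finF: "finite (F s)" for s
    unfolding F_def by (intro finite_subset[OF Collect_restrict finite_PiE]) auto
  have "reduced_exponents {1..m} t k \<subseteq> (\<Union>s\<in>?A. F s)"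
  proof
    fix e assume "e \<in> reduced_exponents {1..m} t k"
    then have e: "e \<in> {1..m} \<rightarrow>\<^sub>E \<beta> ` {1..t}" "(\<Sum>i=1..m. e i) \<le> k"
      unfolding reduced_exponents_def img by auto
    define s where "s = restrict (\<lambda>j. card {i \<in> {1..m}. e i = \<beta> j}) {1..t}"
    have fib: "(\<Sum>i=1..m. h (e i)) = (\<Sum>j=1..t. s j * h (\<beta> j))" for h :: "nat \<Rightarrow> nat"
      using sum_over_fibres[OF _ _ inj, of "{1..m}" e h] e(1) unfolding s_def by auto
    have "(\<Sum>j=1..t. s j) = m"
      using fib[of "\<lambda>_. 1"] by simp
    \<comment> \<open>The term for \<open>j = t\<close> drops out because
      \<open>\<beta> t = 0\<close>.\<close>
    moreover have "(\<Sum>j=1..t. s j * \<beta> j) = (\<Sum>j=1..<t. j * s j)"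
      unfolding t by (auto simp: \<beta>_def intro!: sum.cong)
    ultimately have "s \<in> ?A"
      using fib[of "\<lambda>v. v"] e(2) unfolding s_def by auto
    moreover have "e \<in> F s"
      using e(1) unfolding F_def s_def by auto
    ultimately show "e \<in> (\<Union>s\<in>?A. F s)" by blast
  qed
  then have "card (reduced_exponents {1..m} t k) \<le> card (\<Union>s\<in>?A. F s)"
    using finA finF by (intro card_mono finite_UN_I)
  also have "\<dots> \<le> (\<Sum>s\<in>?A. card (F s))"
    by (rule card_UN_le[OF finA])
  finally have "real (card (reduced_exponents {1..m} t k)) \<le> real (\<Sum>s\<in>?A. card (F s))"
    by (rule of_nat_mono)
  also have "\<dots> = (\<Sum>s\<in>?A. real (card (F s)))"
    by (rule of_nat_sum)
  also have "\<dots> = sum (multinomial m t) ?A"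
    by (intro sum.cong refl cardF)
  finally show ?thesis .
qed

section \<open>Scalar products on \<open>V\<close> and the chromatic bound\<close>

lemma scalar_prod_self_prescribed_vectors:
  assumes "inj_on b {1..t}" "x \<in> prescribed_vectors m t b l"
  shows "scalar_prod m x x = (\<Sum>j=1..t. int (l j) * (b j * b j))"
  using sum_over_fibres[OF _ _ assms(1), of "{1..m}" x "\<lambda>v. v * v"] assms(2)
  unfolding prescribed_vectors_def scalar_prod_def by auto

lemma scalar_prod_polarization:
  "scalar_prod m x x + scalar_prod m y y - 2 * scalar_prod m x y = (\<Sum>i=1..m. (x i - y i)\<^sup>2)"
  unfolding scalar_prod_def
  by (simp add: power2_eq_square algebra_simps sum.distrib sum_subtractf sum_distrib_left)

text \<open>Distinct extensional vectors differ at some index in \<open>{1..m}\<close>, so the sum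
  of squares in the polarization identity is positive.\<close>

lemma scalar_prod_less_of_neq:
  assumes "x \<in> extensional {1..m}" "y \<in> extensional {1..m}" "x \<noteq> y"
    and "scalar_prod m x x = s" "scalar_prod m y y = s"
  shows "scalar_prod m x y < s"
proof -
  obtain i where "i \<in> {1..m}" "x i \<noteq> y i"
    using assms(1-3) by (meson extensionalityI)
  then have "(\<Sum>i=1..m. (x i - y i)\<^sup>2) > 0"
    by (intro sum_pos2[of _ i]) auto
  then show ?thesis
    using scalar_prod_polarization[of m x y] assms(4,5) by simp
qed

theorem theorem9:
  fixes r a' :: real
    and m t d p :: nat
    and b :: "nat \<Rightarrow> int"
    and l :: "nat \<Rightarrow> nat"
    and V :: "(nat \<Rightarrow> int) set"
    and s_max s_min a :: int
    and \<A> :: "(nat \<Rightarrow> nat) set"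
    and L M :: real
  assumes "r > 1/2"
    and "m < CARD('n::finite)"
    and "inj_on b {1..t}"
    and "(\<Sum>j=1..t. l j) = m"
    and "V = prescribed_vectors m t b l"
    and "\<forall>x\<in>V. \<forall>y\<in>V. [scalar_prod m x y = 0] (mod int d)"
    and "\<forall>d'. (\<forall>x\<in>V. \<forall>y\<in>V. [scalar_prod m x y = 0] (mod int d')) \<longrightarrow> d' \<le> d"
    and "s_max = Max {scalar_prod m x y | x y. x \<in> V \<and> y \<in> V}"
    and "s_min = Min {scalar_prod m x y | x y. x \<in> V \<and> y \<in> V}"
    and "sqrt (real_of_int s_max) / sqrt (2 * real_of_int s_max - 2 * a') = r"
    and "prime p"
    and "real p > (real_of_int s_max - a') / real d"
    and "\<forall>q. prime q \<and> real q > (real_of_int s_max - a') / real d \<longrightarrow> p \<le> q"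
    and "a = s_max - int d * int p"
    and "a > s_min"
    and "s_max - 2 * int d * int p < s_min"
    and "L = multinomial m t l"
    and "\<A> = {s \<in> {1..t} \<rightarrow>\<^sub>E UNIV. (\<Sum>i=1..t. s i) = m \<and> (\<Sum>i=1..<t. i * s i) \<le> p - 1}"
    and "M = (\<Sum>s\<in>\<A>. multinomial m t s)"
  shows "real (unit_chromatic_number (sphere (0 :: real ^ 'n) r)) \<ge> L / M"
proof -
  let ?S = "{scalar_prod m x y | x y. x \<in> V \<and> y \<in> V}"
  let ?N = "card (reduced_exponents {1..m} t (p - 1))"
  have VE: "V \<subseteq> {1..m} \<rightarrow>\<^sub>E b ` {1..t}"
    unfolding assms(5) prescribed_vectors_def by auto
  then have finV: "finite V"
    by (rule finite_subset) (intro finite_PiE; simp)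
  have "?S = (\<lambda>(x, y). scalar_prod m x y) ` (V \<times> V)"
    by auto
  then have finS: "finite ?S"
    using finV by simp
  \<comment> \<open>Were \<open>V\<close> empty, every number would be a common divisor vacuously,
    in particular \<open>Suc d\<close>, against the maximality of \<open>d\<close>.\<close>
  obtain x0 where x0: "x0 \<in> V"
    using assms(7)[rule_format, of "Suc d"] by fastforce
  define s where "s = scalar_prod m x0 x0"
  have self_sum: "scalar_prod m x x = (\<Sum>j=1..t. int (l j) * (b j * b j))" if "x \<in> V" for x
    using scalar_prod_self_prescribed_vectors[OF assms(3)] that unfolding assms(5) .
  then have self: "scalar_prod m x x = s" if "x \<in> V" for x
    using that x0 unfolding s_def by simp
  have less: "scalar_prod m x y < s" if "x \<in> V" "y \<in> V" "x \<noteq> y" for x y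
    using that VE self by (intro scalar_prod_less_of_neq) (auto simp: PiE_def)
  have s_max: "s_max = s"
    unfolding assms(8)
  proof (rule Max_eqI[OF finS])
    show "s \<in> ?S" using x0 unfolding s_def by blast
    show "z \<le> s" if "z \<in> ?S" for z
      using that less self by (smt (verit) mem_Collect_eq)
  qed
  have s_min: "s_min \<le> scalar_prod m x y" if "x \<in> V" "y \<in> V" for x y
    unfolding assms(9) using that by (intro Min_le[OF finS]) blast
  \<comment> \<open>For \<open>s = 0\<close> the quotient defining \<open>r\<close> would be
    \<open>0\<close>.\<close>
  have s0: "s \<noteq> 0"
    using assms(1,10) unfolding s_max by auto
  have s_pos: "s > 0"
    using s0 sum_nonneg[of "{1..m}" "\<lambda>i. x0 i * x0 i"] unfolding s_def scalar_prod_def by simp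
  have t: "t > 0"
    using s0 self_sum[OF x0] unfolding s_def by (cases t) auto
  have d_dvd: "int d dvd scalar_prod m x y" if "x \<in> V" "y \<in> V" for x y
    using assms(6) that by (simp add: cong_0_iff)
  have d: "d > 0"
    using d_dvd[OF x0 x0] s0 unfolding s_def by (cases "d = 0") auto
  have p: "p > 0"
    using assms(11) prime_gt_0_nat by blast
  define D where "D = real d * real p"
  have D: "D > 0"
    using d p unfolding D_def by simp
  \<comment> \<open>Here \<open>sqrt\<close> of a negative number is negative and division by zero
    gives zero, so a nonpositive radicand would make \<open>r\<close> nonpositive.\<close>
  have den: "2 * real_of_int s - 2 * a' > 0"
  proof (rule ccontr)
    assume "\<not> ?thesis"
    then have "sqrt (real_of_int s) / sqrt (2 * real_of_int s - 2 * a') \<le> 0"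
      using s_pos by (intro divide_nonneg_nonpos) auto
    then show False using assms(1,10) unfolding s_max by simp
  qed
  have "r\<^sup>2 = real_of_int s / (2 * real_of_int s - 2 * a')"
    using assms(10) den s_pos unfolding s_max by (auto simp: power_divide)
  moreover have "D > real_of_int s - a'"
    using assms(12) d unfolding D_def s_max by (simp add: field_simps)
  \<comment> \<open>The scaled vectors have squared norm \<open>s / (2 * D)\<close>; the slack up to
    the square of \<open>r\<close> becomes the square of the additional coordinate.\<close>
  ultimately have rD: "real_of_int s / (2 * D) \<le> r\<^sup>2"
    using s_pos den D by (auto intro!: divide_left_mono)
  obtain E :: "(nat \<Rightarrow> real) \<Rightarrow> real ^ 'n" where
    E: "\<And>x y. E x \<bullet> E y = (r\<^sup>2 - real_of_int s / (2 * D)) + (\<Sum>i=1..m. x i * y i)"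
    using vec_with_prescribed_inner_products[OF assms(2), of "sqrt (r\<^sup>2 - real_of_int s / (2 * D))"] rD by auto
  \<comment> \<open>With this scale the squared distance is
    \<open>(s - scalar_prod m x y) / D\<close>, which is 1 exactly at scalar product
    \<open>a = s - D\<close>.\<close>
  define \<phi> where "\<phi> x = E (\<lambda>i. real_of_int (x i) / sqrt (2 * D))" for x
  have \<phi>: "\<phi> x \<bullet> \<phi> y = r\<^sup>2 - real_of_int s / (2 * D) + real_of_int (scalar_prod m x y) / (2 * D)" for x y
    unfolding \<phi>_def E scalar_prod_def using D by (simp add: sum_divide_distrib)
  have "norm (\<phi> x) = r" if "x \<in> V" for x
    unfolding norm_eq_sqrt_inner \<phi> self[OF that] using assms(1) by simp
  then have on_sphere: "\<phi> ` V \<subseteq> sphere 0 r" by auto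
  have dist_1: "dist (\<phi> x) (\<phi> y) = 1" if "x \<in> V" "y \<in> V" "scalar_prod m x y = a" for x y
  proof -
    have "(\<phi> x - \<phi> y) \<bullet> (\<phi> x - \<phi> y) = (real_of_int s - real_of_int a) / D"
      unfolding inner_diff_left inner_diff_right inner_commute[of "\<phi> y" "\<phi> x"]
      unfolding \<phi> that(3) self[OF that(1)] self[OF that(2)] using D by (simp add: field_simps)
    also have "\<dots> = 1"
      using d p unfolding assms(14) s_max D_def by simp
    finally show ?thesis
      unfolding dist_norm norm_eq_sqrt_inner by simp
  qed
  have "card W \<le> ?N" if W: "W \<subseteq> V" "\<forall>x\<in>W. \<forall>y\<in>W. dist (\<phi> x) (\<phi> y) \<noteq> 1" for W
  proof -
    \<comment> \<open>A congruence would give \<open>s - scalar_prod m x y = d * p * k\<close>.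
      Strict maximality of \<open>s\<close> on the diagonal and the bound on \<open>s_min\<close>
      leave only \<open>k = 1\<close>, that is the forbidden product \<open>a\<close>.\<close>
    have "\<not> [scalar_prod m x y div int d = s div int d] (mod int p)"
      if xy: "x \<in> W" "y \<in> W" "x \<noteq> y" for x y
    proof
      have V: "x \<in> V" "y \<in> V" using xy W(1) by auto
      obtain u v where u: "scalar_prod m x y = int d * u" and v: "s = int d * v"
        using d_dvd[OF V] d_dvd[OF x0 x0] unfolding s_def dvd_def by blast
      assume "[scalar_prod m x y div int d = s div int d] (mod int p)"
      then have "int p dvd v - u"
        using d unfolding u v by (simp add: cong_iff_dvd_diff dvd_diff_commute)
      then obtain k where "v - u = int p * k" by (elim dvdE)
      then have k: "s - scalar_prod m x y = int d * int p * k"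
        unfolding u v by (simp add: right_diff_distrib[symmetric])
      have dp: "int d * int p > 0" using d p by simp
      have "int d * int p * k > 0"
        using less[OF V xy(3)] unfolding k[symmetric] by simp
      then have "k > 0" using dp by (simp add: zero_less_mult_iff)
      moreover have "int d * int p * k < int d * int p * 2"
        using s_min[OF V] assms(16) unfolding k[symmetric] s_max by (simp add: algebra_simps)
      then have "k < 2" using dp by (simp only: mult_less_cancel_left_pos)
      ultimately have "k = 1" by simp
      then have "scalar_prod m x y = a"
        using k unfolding assms(14) s_max by simp
      then show False using dist_1[OF V] W(2) xy by blast
    qed
    then have "card W \<le> card (reduced_exponents {1..m} (card (b ` {1..t})) (p - 1))"
      using t d assms(11) W(1) VE d_dvd self finite_subset[OF W(1) finV]
      unfolding scalar_prod_def
      by (intro card_le_of_scalar_products_mod_prime[where d = "int d" and \<kappa> = "s div int d"])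
        (auto simp: PiE_def subset_iff)
    then show ?thesis unfolding card_image[OF assms(3)] by simp
  qed
  then have "card V \<le> unit_chromatic_number (sphere (0 :: real ^ 'n) r) * ?N"
    by (rule card_le_chromatic_number_mult_independence[OF compact_sphere finV on_sphere])
  then have "L \<le> real (unit_chromatic_number (sphere (0 :: real ^ 'n) r)) * real ?N"
    unfolding assms(17) card_prescribed_vectors[OF assms(3,4), symmetric] assms(5)[symmetric]
    by (metis of_nat_le_iff of_nat_mult)
  also have "\<dots> \<le> real (unit_chromatic_number (sphere (0 :: real ^ 'n) r)) * M"
    unfolding assms(18,19) by (intro mult_left_mono card_reduced_exponents_le t) simp
  finally have LM: "L \<le> real (unit_chromatic_number (sphere (0 :: real ^ 'n) r)) * M" .
  \<comment> \<open>Positivity of \<open>L\<close> forces \<open>M > 0\<close>, since the chromatic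
    number is nonnegative; this justifies dividing by \<open>M\<close>.\<close>
  have "L > 0"
    unfolding assms(17) multinomial_def by (simp add: prod_pos)
  then have "M > 0"
    using LM by (smt (verit) mult_nonneg_nonpos of_nat_0_le_iff)
  then show ?thesis
    using LM by (simp add: divide_le_eq)
qed

end
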